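(* There exists a family $(\phi_n)_{n\ge1}$ of 3-CNF formulas, $\phi_n$ having $O(n)$ variables (and size polynomial in $n$), such that the extension complexity of the satisfiability polytope of $\phi_n$ is not bounded by any polynomial in $n$, and such that in each $\phi_n$ every variable occurs at most twice non-negated and at most once negated.
   Context: For a CNF formula $\phi$ in variables $x_1,\dots,x_N$, the satisfiability polytope of $\phi$ is the convex hull in $\mathbb{R}^N$ of all 0/1 vectors that are satisfying assignments of $\phi$. A 3-CNF formula is a conjunction of clauses each being a disjunction of three literals. The extension complexity $\mathrm{xc}(Q)$ of a polytope $Q$ is the minimum number of facets of a polytope $Q'$ such that $Q$ is a linear image of $Q'$. *)

theory Defs
  imports "HOL-Analysis.Analysis" "HOL-Library.Function_Algebras"
begin

text \<open>We use the type nat => real as a common ambient space for polytopes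
  of arbitrary (finite) dimension: R^m is identified with the vectors
  supported on {0..<m}.\<close>

instantiation "fun" :: (type, real_vector) real_vector
begin
definition scaleR_fun :: "real \<Rightarrow> ('a \<Rightarrow> 'b) \<Rightarrow> 'a \<Rightarrow> 'b"
  where "scaleR_fun r f = (\<lambda>x. r *\<^sub>R f x)"
instance by standard (auto simp: scaleR_fun_def fun_eq_iff scaleR_add_right scaleR_add_left)
end

text \<open>A literal is a pair (i, b): variable x_i, non-negated if b = True,
  negated if b = False. A CNF formula is a pair (N, cs): N is the number of
  variables (x_0, ..., x_(N-1)) and cs the list of clauses.\<close>

type_synonym lit = "nat \<times> bool"
type_synonym clause = "lit list"
type_synonym cnf = "nat \<times> clause list"

definition nvars :: "cnf \<Rightarrow> nat" where
  "nvars \<phi> = fst \<phi>"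

definition clauses :: "cnf \<Rightarrow> clause list" where
  "clauses \<phi> = snd \<phi>"

definition is_3cnf :: "cnf \<Rightarrow> bool" where
  "is_3cnf \<phi> \<longleftrightarrow>
     (\<forall>c \<in> set (clauses \<phi>). length c = 3 \<and> (\<forall>(i, b) \<in> set c. i < nvars \<phi>))"

definition cnf_size :: "cnf \<Rightarrow> nat" where
  "cnf_size \<phi> = nvars \<phi> + sum_list (map length (clauses \<phi>))"

definition satisfies :: "(nat \<Rightarrow> bool) \<Rightarrow> cnf \<Rightarrow> bool" where
  "satisfies a \<phi> \<longleftrightarrow> (\<forall>c \<in> set (clauses \<phi>). \<exists>(i, b) \<in> set c. a i = b)"

definition pos_occ :: "cnf \<Rightarrow> nat \<Rightarrow> nat" where
  "pos_occ \<phi> i = sum_list (map (\<lambda>c. count_list c (i, True)) (clauses \<phi>))"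

definition neg_occ :: "cnf \<Rightarrow> nat \<Rightarrow> nat" where
  "neg_occ \<phi> i = sum_list (map (\<lambda>c. count_list c (i, False)) (clauses \<phi>))"

definition sat_polytope :: "cnf \<Rightarrow> (nat \<Rightarrow> real) set" where
  "sat_polytope \<phi> = convex hull
     {x. \<exists>a. satisfies a \<phi> \<and> x = (\<lambda>i. if i < nvars \<phi> \<and> a i then 1 else 0)}"

text \<open>Affine dimension and facets, copied from the library definitions
  aff_dim and facet_of, but for arbitrary real vector spaces.\<close>
definition gen_aff_dim :: "'a::real_vector set \<Rightarrow> int" where
  "gen_aff_dim V = (SOME d :: int.
     \<exists>B. affine hull B = affine hull V \<and> \<not> affine_dependent B \<and> of_nat (card B) = d + 1)"

definition gen_facet_of :: "'a::real_vector set \<Rightarrow> 'a set \<Rightarrow> bool" where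
  "gen_facet_of F S \<longleftrightarrow> F face_of S \<and> F \<noteq> {} \<and> gen_aff_dim F = gen_aff_dim S - 1"

definition xc :: "(nat \<Rightarrow> real) set \<Rightarrow> nat" where
  "xc Q = (LEAST k. \<exists>P :: (nat \<Rightarrow> real) set. polytope P \<and>
              (\<exists>f. linear f \<and> f ` P = Q) \<and> card {F. gen_facet_of F P} = k)"

end

theory Submission
  imports Defs "HOL-Library.Discrete_Functions"
begin

text \<open>If \<open>f\<close> maps a polytope \<open>P\<close> onto \<open>Q\<close>, a valid inequality of \<open>Q\<close> pulls back to a face of \<open>P\<close>, and
  a point of \<open>P\<close> outside that face is separated from it by a facet. Hence the facets of \<open>P\<close> give a
  covering of the support of every slack matrix of \<open>Q\<close> by rectangles. For the matrix
  \<open>(1 - |a \<inter> b|)\<^sup>2\<close>, indexed by subsets of an \<open>m\<close>-set, each rectangle contains at most \<open>2 ^ m\<close> of the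
  \<open>3 ^ m\<close> disjoint pairs (Kaibel and Weltge), so the extension complexity is at least about
  \<open>(3/2) ^ m\<close>.

  This matrix is realized by the correlation polytope. Its linear functionals have nonnegative
  coefficients at the product variables, so from the definition of \<open>y_{ij}\<close> as \<open>x_i \<and> x_j\<close> only the
  clause \<open>\<not> x_i \<or> \<not> x_j \<or> y_{ij}\<close> is needed. The variable \<open>x_i\<close> is split into a chain of alternating
  copies and complements \<open>t_0, t_1, \<dots>\<close> with clauses \<open>t_k \<or> t_{k+1} \<or> z_k\<close>: a linear penalty on
  \<open>t_k + t_{k+1} + 2 z_k - 1 \<ge> 0\<close> enforces complementarity, every copy occurs twice non-negated in
  the chain, and each even copy may be used once negated. With \<open>m\<close> about \<open>\<surd>n\<close> this takes
  \<open>O(n)\<close> variables.\<close>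

section \<open>Facets of polytopes in real vector spaces\<close>

text \<open>Steinitz exchange after translation: the differences from a point of \<open>B\<close>
  are independent and lie in the span of the differences from a point of \<open>V\<close>.
  Finiteness of \<open>B\<close> is part of the claim because the ambient space may be
  infinite-dimensional.\<close>

lemma affine_independent_card_le:
  fixes B V :: "'a::real_vector set"
  assumes fin: "finite V" and B: "\<not> affine_dependent B" "B \<subseteq> affine hull V"
  shows "finite B \<and> card B \<le> card V"
proof (cases "B = {}")
  case False
  then obtain b where b: "b \<in> B" by auto
  then obtain v where v: "v \<in> V"
    using B(2) by (metis affine_hull_eq_empty all_not_in_conv subset_empty)
  let ?VV = "(\<lambda>x. -v + x) ` (V - {v})" and ?BB = "(\<lambda>x. -b + x) ` (B - {b})"
  have hull: "x - v \<in> span ?VV" if "x \<in> B" for x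
    using that B(2) affine_hull_span2[OF v] by auto
  have "-b + x \<in> span ?VV" if "x \<in> B" for x
    using span_diff[OF hull[OF that] hull[OF b]] by (simp add: algebra_simps)
  then have "?BB \<subseteq> span ?VV" by auto
  moreover have "independent ?BB"
    using affine_dependent_iff_dependent2[OF b] B(1) by simp
  ultimately have *: "finite ?BB \<and> card ?BB \<le> card ?VV"
    using independent_span_bound[of ?VV ?BB] fin by simp
  have "finite B"
    using * finite_imageD[of "\<lambda>x. -b + x" "B - {b}"] by (simp add: inj_on_def)
  moreover have "card ?BB = card B - 1" "card ?VV = card V - 1"
    using b v fin \<open>finite B\<close> by (auto simp: card_image inj_on_def)
  moreover have "card V > 0" using fin v card_gt_0_iff by blast
  ultimately show ?thesis using * by simp
qed simp

lemma affine_independent_insert_real_vector: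
  fixes B :: "'a::real_vector set"
  assumes "\<not> affine_dependent B" "p \<notin> affine hull B"
  shows "\<not> affine_dependent (insert p B)"
proof -
  obtain T where T: "\<not> affine_dependent T" "B \<subseteq> T" "T \<subseteq> insert p B"
    "affine hull T = affine hull (insert p B)"
    using extend_to_affine_basis[OF assms(1) subset_insertI] by metis
  have "p \<in> affine hull T" using T(4) by (simp add: hull_inc)
  then have "T \<noteq> B" using assms(2) by auto
  then have "T = insert p B" using T(2,3) by blast
  then show ?thesis using T(1) by simp
qed

text \<open>The exchange bound, applied in both directions, pins down the value chosen by
  \<open>SOME\<close>. It also rules out an infinite \<open>B'\<close>, whose \<open>card\<close>
  would be 0.\<close>

lemma gen_aff_dim_eq:
  fixes B S :: "'a::real_vector set"
  assumes "finite B" "\<not> affine_dependent B" "affine hull B = affine hull S"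
  shows "gen_aff_dim S = int (card B) - 1"
  unfolding gen_aff_dim_def
proof (rule some_equality)
  show "\<exists>B'. affine hull B' = affine hull S \<and> \<not> affine_dependent B' \<and>
      of_nat (card B') = int (card B) - 1 + 1"
    using assms by auto
next
  fix d :: int
  assume "\<exists>B'. affine hull B' = affine hull S \<and> \<not> affine_dependent B' \<and> of_nat (card B') = d + 1"
  then obtain B' where B': "affine hull B' = affine hull S" "\<not> affine_dependent B'"
    "int (card B') = d + 1" by auto
  have "B' \<subseteq> affine hull B" using B'(1) assms(3) hull_subset[of B' affine] by simp
  from affine_independent_card_le[OF assms(1) B'(2) this]
  have *: "finite B'" "card B' \<le> card B" by auto
  have "B \<subseteq> affine hull B'" using B'(1) assms(3) hull_subset[of B affine] by simp
  from affine_independent_card_le[OF *(1) assms(2) this] * B'(3)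
  show "d = int (card B) - 1" by simp
qed

text \<open>In a convex combination representing a point \<open>x\<close> of \<open>F\<close>, each
  vertex \<open>v\<close> of positive weight lies in \<open>F\<close>: apart from degenerate cases,
  \<open>x\<close> is in the open segment from the weighted average \<open>r\<close> of the other
  vertices to \<open>v\<close>.\<close>

lemma face_of_convex_hull_eq:
  fixes V F :: "'a::real_vector set"
  assumes fin: "finite V" and F: "F face_of (convex hull V)"
  shows "F = convex hull (V \<inter> F)"
proof
  have sub: "F \<subseteq> convex hull V" and cvx: "convex F"
    and ext: "\<And>a b x. a \<in> convex hull V \<Longrightarrow> b \<in> convex hull V \<Longrightarrow> x \<in> F \<Longrightarrow>
                x \<in> open_segment a b \<Longrightarrow> b \<in> F"
    using F unfolding face_of_def by blast+
  show "convex hull (V \<inter> F) \<subseteq> F"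
    using cvx by (simp add: hull_minimal)
  show "F \<subseteq> convex hull (V \<inter> F)"
  proof
    fix x assume x: "x \<in> F"
    then obtain u where u: "\<And>v. v \<in> V \<Longrightarrow> 0 \<le> u v" "sum u V = 1" "(\<Sum>v\<in>V. u v *\<^sub>R v) = x"
      using sub convex_hull_finite[OF fin] by auto
    have inF: "v \<in> F" if v: "v \<in> V" "u v > 0" for v
    proof -
      have s: "sum u (V - {v}) = 1 - u v" "(\<Sum>w\<in>V-{v}. u w *\<^sub>R w) = x - u v *\<^sub>R v"
        using u v fin by (simp_all add: sum_diff1)
      show ?thesis
      proof (cases "u v = 1")
        case True
        then have "\<forall>w\<in>V-{v}. u w = 0"
          using s(1) sum_nonneg_eq_0_iff[of "V-{v}" u] fin u(1) by auto
        then have "(\<Sum>w\<in>V-{v}. u w *\<^sub>R w) = 0" by simp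
        then show ?thesis using s(2) True x by simp
      next
        case False
        have "0 \<le> sum u (V - {v})" using u(1) by (intro sum_nonneg) auto
        then have lt: "u v < 1" using False s(1) by simp
        define r where "r = (\<Sum>w\<in>V-{v}. (u w / (1 - u v)) *\<^sub>R w)"
        have "r \<in> convex hull (V - {v})"
          unfolding convex_hull_finite[OF finite_Diff[OF fin]] r_def
          using u(1) lt s(1)
          by (intro CollectI exI[of _ "\<lambda>w. u w / (1 - u v)"])
            (auto simp: sum_divide_distrib[symmetric])
        then have rV: "r \<in> convex hull V" by (meson Diff_subset hull_mono subsetD)
        have "(1 - u v) *\<^sub>R r = (\<Sum>w\<in>V-{v}. u w *\<^sub>R w)"
          unfolding r_def scaleR_sum_right using lt by (intro sum.cong) auto
        then have xr: "x = (1 - u v) *\<^sub>R r + u v *\<^sub>R v" using s(2) by simp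
        show ?thesis
        proof (cases "r = v")
          case True
          then have "x = v" using xr by (simp add: scaleR_add_left[symmetric])
          then show ?thesis using x by simp
        next
          case False
          then have "x \<in> open_segment r v" using xr v lt by (auto simp: in_segment)
          then show ?thesis using ext[OF rV _ x] hull_inc[OF v(1)] by blast
        qed
      qed
    qed
    have z: "u v = 0" if "v \<in> V - V \<inter> F" for v
      using that inF u(1)[of v] by force
    have "sum u (V \<inter> F) = 1"
      using u(2) sum.mono_neutral_right[OF fin, of "V \<inter> F" u] z by auto
    moreover have "(\<Sum>v\<in>V \<inter> F. u v *\<^sub>R v) = x"
      using u(3) sum.mono_neutral_right[OF fin, of "V \<inter> F" "\<lambda>v. u v *\<^sub>R v"] z by auto
    ultimately show "x \<in> convex hull (V \<inter> F)"
      using u(1) by (auto simp: convex_hull_finite[OF finite_Int[OF disjI1[OF fin]]])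
  qed
qed

text \<open>A facet is determined by the points of \<open>V\<close> that it contains. Finiteness
  makes the facet count in \<open>xc\<close> meaningful, as \<open>card\<close> of an infinite set
  is 0.\<close>

lemma finite_gen_facets:
  fixes P :: "'a::real_vector set"
  assumes "polytope P"
  shows "finite {F. gen_facet_of F P}"
proof -
  obtain V where V: "finite V" "P = convex hull V" using assms unfolding polytope_def by auto
  have "F \<in> (\<lambda>W. convex hull W) ` Pow V" if "gen_facet_of F P" for F
  proof (rule image_eqI)
    show "F = convex hull (V \<inter> F)"
      using that face_of_convex_hull_eq[OF V(1), of F] V(2) unfolding gen_facet_of_def by simp
  qed auto
  then have "{F. gen_facet_of F P} \<subseteq> (\<lambda>W. convex hull W) ` Pow V" by auto
  then show ?thesis using V(1) by (auto intro: finite_subset)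
qed

section \<open>Valid inequalities and the faces they expose\<close>

lemma affine_nonneg_on_convex_hull:
  assumes l: "linear (l :: 'a::real_vector \<Rightarrow> real)" and "\<And>v. v \<in> V \<Longrightarrow> l v + c \<ge> 0" "x \<in> convex hull V"
  shows "l x + c \<ge> 0"
proof -
  have "convex {x. l x + c \<ge> 0}"
  proof (rule convexI)
    fix x y u v
    assume "x \<in> {x. l x + c \<ge> 0}" "y \<in> {x. l x + c \<ge> 0}"
      and uv: "0 \<le> u" "0 \<le> v" "(u::real) + v = 1"
    then have "0 \<le> u * (l x + c) + v * (l y + c)" by simp
    also have "\<dots> = u * l x + v * l y + (u + v) * c" by (simp add: algebra_simps)
    finally show "u *\<^sub>R x + v *\<^sub>R y \<in> {x. l x + c \<ge> 0}"
      using uv(3) by (simp add: linear_add[OF l] linear_cmul[OF l])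
  qed
  then have "convex hull V \<subseteq> {x. l x + c \<ge> 0}"
    using assms(2) by (intro hull_minimal) auto
  then show ?thesis using assms(3) by auto
qed

lemma affine_zero_on_affine_hull:
  assumes l: "linear (l :: 'a::real_vector \<Rightarrow> real)" and "\<And>v. v \<in> V \<Longrightarrow> l v + c = 0" "x \<in> affine hull V"
  shows "l x + c = 0"
proof -
  have "affine {x. l x + c = 0}"
    unfolding affine_def
  proof clarify
    fix x y u v
    assume "l x + c = 0" "l y + c = 0" and uv: "(u::real) + v = 1"
    then have "0 = u * (l x + c) + v * (l y + c)" by simp
    also have "\<dots> = u * l x + v * l y + (u + v) * c" by (simp add: algebra_simps)
    finally show "l (u *\<^sub>R x + v *\<^sub>R y) + c = 0"
      using uv by (simp add: linear_add[OF l] linear_cmul[OF l])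
  qed
  then have "affine hull V \<subseteq> {x. l x + c = 0}"
    using assms(2) by (intro hull_minimal) auto
  then show ?thesis using assms(3) by auto
qed

lemma face_of_affine_zero_set:
  assumes l: "linear (l :: 'a::real_vector \<Rightarrow> real)" and P: "convex P"
    and nn: "\<And>x. x \<in> P \<Longrightarrow> l x + c \<ge> 0"
  shows "{x \<in> P. l x + c = 0} face_of P"
proof -
  have "convex (P \<inter> l -` {-c})"
    by (intro convex_Int P convex_linear_vimage l) auto
  moreover have "{x \<in> P. l x + c = 0} = P \<inter> l -` {-c}" by auto
  ultimately have cv: "convex {x \<in> P. l x + c = 0}" by simp
  have "l a + c = 0 \<and> l b + c = 0"
    if ab: "a \<in> P" "b \<in> P" "l x + c = 0" "x \<in> open_segment a b" for a b x
  proof -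
    obtain u where u: "0 < u" "u < 1" "x = (1 - u) *\<^sub>R a + u *\<^sub>R b"
      using ab(4) by (auto simp: in_segment)
    have "l x = (1 - u) * l a + u * l b"
      by (simp add: u(3) linear_add[OF l] linear_cmul[OF l])
    then have "(1 - u) * (l a + c) + u * (l b + c) = 0"
      using ab(3) by (simp add: algebra_simps)
    moreover have "0 \<le> (1 - u) * (l a + c)" "0 \<le> u * (l b + c)"
      using u nn[OF ab(1)] nn[OF ab(2)] by auto
    ultimately have "(1 - u) * (l a + c) = 0" "u * (l b + c) = 0" by linarith+
    then show ?thesis using u by auto
  qed
  with cv show ?thesis unfolding face_of_def by blast
qed

text \<open>With \<open>p\<close> moved to the origin, \<open>v - p\<close> lies outside the span of
  the translated \<open>B\<close>. It can be adjoined to a basis of that span, and the functional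
  with value 1 at \<open>v - p\<close> and 0 on the basis extends to the whole space.\<close>

lemma separating_functional_affine_hull:
  fixes B :: "'a::real_vector set"
  assumes v: "v \<notin> affine hull (insert p B)"
  obtains w :: "'a \<Rightarrow> real" where "linear w" "\<And>b. b \<in> B \<Longrightarrow> w b = w p" "w v \<noteq> w p"
proof -
  let ?S = "(\<lambda>x. -p + x) ` B"
  have nin: "v - p \<notin> span ?S"
  proof
    assume "v - p \<in> span ?S"
    then have "p + (v - p) \<in> (\<lambda>x. p + x) ` span ?S" by (rule imageI)
    then show False using v affine_hull_insert_span_gen[of p B] by simp
  qed
  obtain C where C: "C \<subseteq> ?S" "independent C" "?S \<subseteq> span C"
    using maximal_independent_subset[of ?S] by blast
  then have "v - p \<notin> span C" using nin span_mono by blast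
  then have ind: "independent (insert (v - p) C)"
    using C(2) by (simp add: independent_insertI)
  have "v - p \<notin> C" using \<open>v - p \<notin> span C\<close> span_base by blast
  obtain w :: "'a \<Rightarrow> real" where w: "linear w"
    "\<forall>x\<in>insert (v - p) C. w x = (if x = v - p then 1 else 0)"
    using linear_independent_extend[OF ind, of "\<lambda>x. if x = v - p then 1 else 0 :: real"] by auto
  have C0: "\<And>x. x \<in> C \<Longrightarrow> w x = 0" using w(2) \<open>v - p \<notin> C\<close> by auto
  show ?thesis
  proof
    show "linear w" by fact
    show "w v \<noteq> w p" using w by (auto simp: linear_diff)
    fix b assume "b \<in> B"
    then have "-p + b \<in> span C" using C by auto
    then have "w (-p + b) = 0" using linear_eq_0_on_span[OF w(1) C0] by blast
    then show "w b = w p" using linear_diff[OF w(1), of b p] by simp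
  qed
qed

text \<open>Among the functionals that are nonnegative on the polytope, vanish on the given face and are
  positive at \<open>p\<close>, one with the most zero vertices exposes a facet: otherwise it could be tilted
  about its zero set and \<open>p\<close> until it hits a further vertex.\<close>

lemma facet_separating_from_face:
  fixes P :: "'a::real_vector set" and l :: "'a \<Rightarrow> real"
  assumes P: "polytope P" and l: "linear l" and nn: "\<And>x. x \<in> P \<Longrightarrow> l x + c \<ge> 0"
    and p: "p \<in> P" "l p + c > 0" and q: "q \<in> P" "l q + c = 0"
  obtains F where "gen_facet_of F P" "{x \<in> P. l x + c = 0} \<subseteq> F" "p \<notin> F"
proof -
  obtain V where V: "finite V" "P = convex hull V" using P unfolding polytope_def by auto
  have VP: "V \<subseteq> P" using V(2) by (simp add: hull_subset)
  have cP: "convex P" using V(2) by simp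
  define G where "G = {x \<in> P. l x + c = 0}"
  have GF: "G = convex hull (V \<inter> G)"
    using face_of_convex_hull_eq[OF V(1)] face_of_affine_zero_set[OF l cP nn] V(2)
    unfolding G_def by auto
  define A where "A h d \<longleftrightarrow> linear h \<and> (\<forall>v\<in>V. h v + d \<ge> 0) \<and> (\<forall>v\<in>V \<inter> G. h v + d = 0) \<and> h p + d > 0"
    for h :: "'a \<Rightarrow> real" and d
  define Z where "Z hd = card {v \<in> V. fst hd v + snd hd = 0}" for hd :: "('a \<Rightarrow> real) \<times> real"
  have "A l c" unfolding A_def using l nn VP p by (auto simp: G_def)
  moreover have "\<forall>hd. A (fst hd) (snd hd) \<longrightarrow> Z hd < Suc (card V)"
    unfolding Z_def by (auto intro!: card_mono V(1) le_imp_less_Suc)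
  ultimately obtain hd where hd: "A (fst hd) (snd hd)"
    "\<And>hd'. A (fst hd') (snd hd') \<Longrightarrow> Z hd' \<le> Z hd"
    using ex_has_greatest_nat[of "\<lambda>hd. A (fst hd) (snd hd)" "(l, c)" Z "Suc (card V)"] by force
  obtain h d where hd_eq: "hd = (h, d)" by fastforce
  have A: "A h d" and max: "\<And>h' d'. A h' d' \<Longrightarrow> Z (h', d') \<le> Z (h, d)"
    using hd hd_eq by force+
  have h: "linear h" and hnn: "\<And>v. v \<in> V \<Longrightarrow> h v + d \<ge> 0"
    and hG: "\<And>v. v \<in> V \<Longrightarrow> v \<in> G \<Longrightarrow> h v + d = 0" and hp: "h p + d > 0"
    using A unfolding A_def by auto
  define F where "F = {x \<in> P. h x + d = 0}"
  have hnnP: "h x + d \<ge> 0" if "x \<in> P" for x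
    using affine_nonneg_on_convex_hull[OF h hnn] that V(2) by blast
  have face: "F face_of P"
    unfolding F_def by (rule face_of_affine_zero_set[OF h cP hnnP])
  then have cF: "convex F" by (simp add: face_of_imp_convex)
  have "V \<inter> G \<subseteq> F" using hG VP unfolding F_def by auto
  then have GsubF: "G \<subseteq> F" using GF cF by (metis hull_minimal)
  have pF: "p \<notin> F" using hp unfolding F_def by auto
  have ne: "F \<noteq> {}" using q GsubF unfolding G_def by auto
  obtain B where B: "B \<subseteq> F" "\<not> affine_dependent B" "affine hull F = affine hull B"
    using affine_basis_exists by blast
  have "F \<subseteq> affine hull V"
    using V(2) convex_hull_subset_affine_hull unfolding F_def by blast
  then have finB: "finite B" using affine_independent_card_le[OF V(1) B(2)] B(1) by blast
  have B0: "h b + d = 0" if "b \<in> affine hull B" for b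
    by (rule affine_zero_on_affine_hull[OF h _ that]) (use B(1) in \<open>auto simp: F_def\<close>)
  have pB: "p \<notin> affine hull B" using B0[of p] hp by auto
  then have ind: "\<not> affine_dependent (insert p B)"
    by (rule affine_independent_insert_real_vector[OF B(2)])
  have sub: "V \<subseteq> affine hull (insert p B)"
  proof (rule ccontr)
    assume "\<not> V \<subseteq> affine hull (insert p B)"
    then obtain v0 where v0: "v0 \<in> V" "v0 \<notin> affine hull (insert p B)" by auto
    obtain w' :: "'a \<Rightarrow> real" where w': "linear w'" "\<And>b. b \<in> B \<Longrightarrow> w' b = w' p" "w' v0 \<noteq> w' p"
      using separating_functional_affine_hull[OF v0(2)] by blast
    \<comment> \<open>The sign is chosen so that \<open>w\<close> drops from \<open>p\<close> to
      \<open>v0\<close>; hence \<open>N\<close> below is nonempty and its minimum exists.\<close>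
    define w where "w = (\<lambda>x. (if w' v0 < w' p then 1 else -1) * w' x)"
    have w: "linear w" "\<And>b. b \<in> B \<Longrightarrow> w b = w p" "w v0 < w p"
      using w' unfolding w_def
      by (auto simp: linear_add linear_cmul algebra_simps intro!: linearI)
    have wB: "w x + (- w p) = 0" if "x \<in> affine hull B" for x
      by (rule affine_zero_on_affine_hull[OF w(1) _ that]) (use w(2) in auto)
    have wF: "w x = w p" if "x \<in> F" for x
      using wB[of x] B(3) hull_subset[of F affine] that by auto
    define N where "N = {v \<in> V. w v < w p}"
    \<comment> \<open>Ratio test: \<open>t\<close> is the largest multiple for which adding
      \<open>t * (w - w p)\<close> keeps the functional nonnegative on \<open>V\<close>. As
      \<open>w\<close> equals \<open>w p\<close> on \<open>F\<close> and at \<open>p\<close>,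
      nothing changes there, while a minimizer \<open>v1\<close> becomes a new zero.\<close>
    define t where "t = Min ((\<lambda>v. (h v + d) / (w p - w v)) ` N)"
    have N: "finite N" "N \<noteq> {}" using V(1) v0 w(3) unfolding N_def by auto
    have "t \<in> (\<lambda>v. (h v + d) / (w p - w v)) ` N"
      unfolding t_def using N by (intro Min_in) auto
    then obtain v1 where v1: "v1 \<in> N" "t = (h v1 + d) / (w p - w v1)" by auto
    have tmin: "t \<le> (h v + d) / (w p - w v)" if "v \<in> N" for v
      unfolding t_def using N that by (intro Min_le) auto
    have t0: "t \<ge> 0" using v1 hnn[of v1] unfolding N_def by auto
    define h' where "h' = (\<lambda>x. h x + t * w x)"
    define d' where "d' = d - t * w p"
    have eq: "h' x + d' = h x + d - t * (w p - w x)" for x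
      unfolding h'_def d'_def by (simp add: algebra_simps)
    have lin': "linear h'"
      unfolding h'_def
      by (rule linearI) (simp_all add: linear_add[OF h] linear_add[OF w(1)] linear_cmul[OF h]
          linear_cmul[OF w(1)] algebra_simps)
    have nn': "h' v + d' \<ge> 0" if "v \<in> V" for v
    proof (cases "v \<in> N")
      case True
      then have "t * (w p - w v) \<le> h v + d"
        using tmin[OF True] by (simp add: N_def pos_le_divide_eq)
      then show ?thesis using eq by simp
    next
      case False
      then have "w p - w v \<le> 0" using that unfolding N_def by auto
      then have "t * (w p - w v) \<le> 0" using t0 by (simp add: mult_nonneg_nonpos)
      then show ?thesis using eq[of v] hnn[OF that] by simp
    qed
    have zero': "h' x + d' = 0" if "x \<in> F" for x
      using that wF[OF that] eq[of x] unfolding F_def by simp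
    have "A h' d'"
      unfolding A_def using lin' nn' zero' GsubF eq[of p] hp by auto
    then have le: "Z (h', d') \<le> Z (h, d)" by (rule max)
    have v1V: "v1 \<in> V" "w v1 < w p" using v1(1) unfolding N_def by auto
    have "h' v1 + d' = 0" using eq[of v1] v1 unfolding N_def by auto
    moreover have "h v1 + d \<noteq> 0" using wF[of v1] v1V VP unfolding F_def by auto
    moreover have "{v \<in> V. h v + d = 0} \<subseteq> {v \<in> V. h' v + d' = 0}"
      using zero' VP unfolding F_def by auto
    ultimately have "{v \<in> V. h v + d = 0} \<subset> {v \<in> V. h' v + d' = 0}" using v1V by auto
    then have "Z (h, d) < Z (h', d')"
      unfolding Z_def fst_conv snd_conv using V(1) by (intro psubset_card_mono) auto
    then show False using le by simp
  qed
  \<comment> \<open>Thus \<open>B\<close> is an affine basis of \<open>F\<close> and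
    \<open>insert p B\<close> one of \<open>P\<close>, so the dimensions differ by exactly
    one.\<close>
  have "P \<subseteq> affine hull (insert p B)"
    using V(2) sub by (metis affine_affine_hull affine_imp_convex hull_minimal)
  moreover have "insert p B \<subseteq> P" using p B(1) unfolding F_def by auto
  ultimately have hullP: "affine hull (insert p B) = affine hull P"
    by (metis hull_hull hull_mono subset_antisym)
  have "p \<notin> B" using pB hull_inc by metis
  then have "gen_aff_dim P = int (card B)"
    using gen_aff_dim_eq[OF _ ind hullP] finB by simp
  moreover have "gen_aff_dim F = int (card B) - 1"
    using gen_aff_dim_eq[OF finB B(2)] B(3) by simp
  ultimately have "gen_facet_of F P"
    unfolding gen_facet_of_def using face ne by simp
  then show ?thesis using that GsubF pF unfolding G_def by blast
qed

section \<open>Rectangle coverings and extension complexity\<close>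

definition disjoint_pairs :: "'a set set \<Rightarrow> 'a set set \<Rightarrow> ('a set \<times> 'a set) set" where
  "disjoint_pairs A B = {(a, b) \<in> A \<times> B. a \<inter> b = {}}"

lemma finite_disjoint_pairs [intro]:
  "finite A \<Longrightarrow> finite B \<Longrightarrow> finite (disjoint_pairs A B)"
  unfolding disjoint_pairs_def by (rule finite_subset[of _ "A \<times> B"]) auto

text \<open>In the induction step, \<open>A0\<close>, \<open>B0\<close> are the members avoiding \<open>n\<close> and \<open>A1\<close>, \<open>B1\<close> the traces of
  those containing it; all disjoint pairs are accounted for by the two rectangles
  \<open>(A0 \<union> A1) \<times> B0\<close> and \<open>A0 \<times> (B0 \<union> B1)\<close>.\<close>

lemma card_disjoint_pairs_rectangle:
  fixes A B :: "nat set set"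
  assumes "A \<subseteq> Pow {..<n}" "B \<subseteq> Pow {..<n}"
    and "\<And>a b. a \<in> A \<Longrightarrow> b \<in> B \<Longrightarrow> card (a \<inter> b) \<noteq> 1"
  shows "card (disjoint_pairs A B) \<le> 2 ^ n"
  using assms
proof (induction n arbitrary: A B)
  case 0
  then have "disjoint_pairs A B \<subseteq> {({}, {})}" unfolding disjoint_pairs_def by auto
  then have "card (disjoint_pairs A B) \<le> card {({}, {}) :: nat set \<times> nat set}"
    by (intro card_mono) auto
  then show ?case by simp
next
  case (Suc n)
  define A0 B0 where "A0 = A \<inter> Pow {..<n}" and "B0 = B \<inter> Pow {..<n}"
  define A1 B1 where "A1 = {a \<in> Pow {..<n}. insert n a \<in> A}" and "B1 = {b \<in> Pow {..<n}. insert n b \<in> B}"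
  note defs = A0_def B0_def A1_def B1_def
  let ?D = disjoint_pairs
  have subs: "A0 \<subseteq> Pow {..<n}" "A1 \<subseteq> Pow {..<n}" "B0 \<subseteq> Pow {..<n}" "B1 \<subseteq> Pow {..<n}"
    unfolding defs by auto
  have fin: "finite A0" "finite A1" "finite B0" "finite B1"
    using subs by (auto intro: finite_subset[OF _ finite_Pow_iff[THEN iffD2, OF finite_lessThan]])
  have ins: "insert n a \<inter> b = a \<inter> b" "a \<inter> insert n b = a \<inter> b"
      "insert n a \<inter> insert n b = insert n (a \<inter> b)"
    if "a \<subseteq> {..<n}" "b \<subseteq> {..<n}" for a b :: "nat set"
    using that by auto
  have split: "x \<subseteq> {..<n} \<or> (\<exists>y\<subseteq>{..<n}. x = insert n y)" if "x \<subseteq> {..<Suc n}" for x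
  proof (cases "n \<in> x")
    case True
    then have "x = insert n (x - {n})" "x - {n} \<subseteq> {..<n}" using that by (auto simp: lessThan_Suc)
    then show ?thesis by metis
  next
    case False
    then have "x \<subseteq> {..<n}" using that by (auto simp: lessThan_Suc)
    then show ?thesis by simp
  qed
  have "?D A B \<subseteq> ?D A0 B0 \<union> ((\<lambda>(a, b). (insert n a, b)) ` ?D A1 B0 \<union>
      (\<lambda>(a, b). (a, insert n b)) ` ?D A0 B1)"
  proof (rule subrelI)
    fix a b assume ab: "(a, b) \<in> ?D A B"
    then have mem: "a \<in> A" "b \<in> B" "a \<inter> b = {}" unfolding disjoint_pairs_def by auto
    then have "a \<subseteq> {..<Suc n}" "b \<subseteq> {..<Suc n}" using Suc.prems by auto
    then consider "a \<subseteq> {..<n}" "b \<subseteq> {..<n}"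
      | a' where "a' \<subseteq> {..<n}" "a = insert n a'" "b \<subseteq> {..<n}"
      | b' where "a \<subseteq> {..<n}" "b' \<subseteq> {..<n}" "b = insert n b'"
      using split mem(3) by (metis insert_disjoint(1) insertI1)
    then show "(a, b) \<in> ?D A0 B0 \<union> ((\<lambda>(a, b). (insert n a, b)) ` ?D A1 B0 \<union>
      (\<lambda>(a, b). (a, insert n b)) ` ?D A0 B1)"
    proof cases
      case 2
      then have "(a', b) \<in> ?D A1 B0" using mem unfolding disjoint_pairs_def defs by auto
      then show ?thesis using 2 by force
    next
      case 3
      then have "(a, b') \<in> ?D A0 B1" using mem unfolding disjoint_pairs_def defs by auto
      then show ?thesis using 3 by force
    qed (use mem in \<open>auto simp: disjoint_pairs_def defs\<close>)
  qed
  then have "card (?D A B) \<le> card (?D A0 B0 \<union> ((\<lambda>(a, b). (insert n a, b)) ` ?D A1 B0 \<union>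
      (\<lambda>(a, b). (a, insert n b)) ` ?D A0 B1))"
    using fin by (intro card_mono) auto
  also have "\<dots> \<le> card (?D A0 B0) + (card (?D A1 B0) + card (?D A0 B1))"
    using fin by (intro card_Un_le[THEN order_trans] add_mono card_image_le) auto
  also have "\<dots> = (card (?D A0 B0) + card (?D A1 B0)) + card (?D A0 B1)" by simp
  \<comment> \<open>Inclusion-exclusion merges two terms into the first rectangle and leaves the
    overlap over \<open>A0 \<inter> A1\<close>, which fits into the second rectangle next to the
    remaining term.\<close>
  also have "card (?D A0 B0) + card (?D A1 B0) = card (?D (A0 \<union> A1) B0) + card (?D (A0 \<inter> A1) B0)"
  proof -
    have "?D A0 B0 \<union> ?D A1 B0 = ?D (A0 \<union> A1) B0" "?D A0 B0 \<inter> ?D A1 B0 = ?D (A0 \<inter> A1) B0"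
      unfolding disjoint_pairs_def by auto
    then show ?thesis using card_Un_Int[of "?D A0 B0" "?D A1 B0"] fin by auto
  qed
  also have "card (?D (A0 \<union> A1) B0) + card (?D (A0 \<inter> A1) B0) + card (?D A0 B1)
      \<le> card (?D (A0 \<union> A1) B0) + card (?D A0 (B0 \<union> B1))"
  proof -
    \<comment> \<open>A common pair would have \<open>a\<close> in \<open>A1\<close> and
      \<open>b\<close> in \<open>B1\<close>; then \<open>insert n a\<close> and
      \<open>insert n b\<close> would meet exactly in \<open>n\<close>, which the hypothesis
      forbids.\<close>
    have "?D (A0 \<inter> A1) B0 \<inter> ?D A0 B1 = {}"
    proof (intro equals0I)
      fix x assume "x \<in> ?D (A0 \<inter> A1) B0 \<inter> ?D A0 B1"
      then obtain a b where "a \<in> A1" "b \<in> B1" "a \<inter> b = {}"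
        unfolding disjoint_pairs_def by auto
      then show False
        using Suc.prems(3)[of "insert n a" "insert n b"] ins(3)[of a b] unfolding defs by simp
    qed
    then have "card (?D (A0 \<inter> A1) B0) + card (?D A0 B1) = card (?D (A0 \<inter> A1) B0 \<union> ?D A0 B1)"
      using fin by (subst card_Un_disjoint) auto
    also have "\<dots> \<le> card (?D A0 (B0 \<union> B1))"
      using fin by (intro card_mono finite_disjoint_pairs finite_UnI) (auto simp: disjoint_pairs_def)
    finally show ?thesis by simp
  qed
  \<comment> \<open>The induction hypothesis applies to both rectangles: \<open>n\<close> lies in at
    most one of the two original sets, so removing it leaves the intersection unchanged.\<close>
  also have "card (?D (A0 \<union> A1) B0) \<le> 2 ^ n"
  proof (rule Suc.IH)
    fix a b assume ab: "a \<in> A0 \<union> A1" "b \<in> B0"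
    then show "card (a \<inter> b) \<noteq> 1"
      using Suc.prems(3)[of a b] Suc.prems(3)[of "insert n a" b] ins(1)[of a b] unfolding defs by auto
  qed (use subs in auto)
  also have "card (?D A0 (B0 \<union> B1)) \<le> 2 ^ n"
  proof (rule Suc.IH)
    fix a b assume ab: "a \<in> A0" "b \<in> B0 \<union> B1"
    then show "card (a \<inter> b) \<noteq> 1"
      using Suc.prems(3)[of a b] Suc.prems(3)[of a "insert n b"] ins(2)[of a b] unfolding defs by auto
  qed (use subs in auto)
  finally show ?case by simp
qed

text \<open>Each of the \<open>n\<close> elements lies in the first set, in the second, or in
  neither.\<close>

lemma card_disjoint_pairs_Pow:
  "card (disjoint_pairs (Pow {..<n}) (Pow {..<n :: nat})) = 3 ^ n"
proof (induction n)
  case 0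
  have "disjoint_pairs (Pow {..<0}) (Pow {..<0 :: nat}) = {({}, {})}"
    unfolding disjoint_pairs_def by auto
  then show ?case by simp
next
  case (Suc n)
  let ?D = "\<lambda>n. disjoint_pairs (Pow {..<n}) (Pow {..<n :: nat})"
  let ?f = "\<lambda>(a, b). (insert n a, b)" and ?g = "\<lambda>(a, b). (a, insert n b)"
  have sub: "a \<subseteq> {..<n} \<and> b \<subseteq> {..<n} \<and> n \<notin> a \<and> n \<notin> b" if "(a, b) \<in> ?D n" for a b
    using that unfolding disjoint_pairs_def by auto
  have fin: "finite (?D n)" by auto
  have "?D (Suc n) = ?D n \<union> (?f ` ?D n \<union> ?g ` ?D n)"
  proof
    show "?D n \<union> (?f ` ?D n \<union> ?g ` ?D n) \<subseteq> ?D (Suc n)"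
      by (auto simp: disjoint_pairs_def less_Suc_eq subset_iff)
    show "?D (Suc n) \<subseteq> ?D n \<union> (?f ` ?D n \<union> ?g ` ?D n)"
    proof (rule subrelI, rule ccontr)
      fix a b assume ab: "(a, b) \<in> ?D (Suc n)"
        and nin: "(a, b) \<notin> ?D n \<union> (?f ` ?D n \<union> ?g ` ?D n)"
      then have r: "(a - {n}, b - {n}) \<in> ?D n"
        by (auto simp: disjoint_pairs_def lessThan_Suc subset_iff)
      have "n \<notin> a"
      proof
        assume "n \<in> a"
        then have "n \<notin> b" using ab(1) unfolding disjoint_pairs_def by auto
        then have "(a, b) = ?f (a - {n}, b - {n})" using \<open>n \<in> a\<close> by auto
        then show False using nin r by blast
      qed
      moreover have "n \<notin> b"
      proof
        assume "n \<in> b"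
        then have "(a, b) = ?g (a - {n}, b - {n})" using \<open>n \<notin> a\<close> by auto
        then show False using nin r by blast
      qed
      ultimately show False using r nin by simp
    qed
  qed
  moreover have "?D n \<inter> (?f ` ?D n \<union> ?g ` ?D n) = {}" "?f ` ?D n \<inter> ?g ` ?D n = {}"
    using sub by fastforce+
  moreover have "inj_on ?f (?D n)" "inj_on ?g (?D n)"
    using sub by (auto simp: inj_on_def dest!: insert_ident[THEN iffD1, rotated 2])
  ultimately have "card (?D (Suc n)) = card (?D n) + (card (?D n) + card (?D n))"
    using fin by (simp add: card_Un_disjoint card_image)
  then show ?case using Suc.IH by simp
qed

lemma rectangle_cover_card:
  fixes A B :: "'i \<Rightarrow> nat set set"
  assumes fin: "finite I"
    and sub: "\<And>i. i \<in> I \<Longrightarrow> A i \<subseteq> Pow {..<n}" "\<And>i. i \<in> I \<Longrightarrow> B i \<subseteq> Pow {..<n}"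
    and ne1: "\<And>i a b. i \<in> I \<Longrightarrow> a \<in> A i \<Longrightarrow> b \<in> B i \<Longrightarrow> card (a \<inter> b) \<noteq> 1"
    and cover: "\<And>a b. a \<subseteq> {..<n} \<Longrightarrow> b \<subseteq> {..<n} \<Longrightarrow> a \<inter> b = {} \<Longrightarrow> \<exists>i\<in>I. a \<in> A i \<and> b \<in> B i"
  shows "3 ^ n \<le> card I * 2 ^ n"
proof -
  have "finite (A i)" "finite (B i)" if "i \<in> I" for i
    using sub[OF that] by (auto intro: finite_subset[OF _ finite_Pow_iff[THEN iffD2, OF finite_lessThan]])
  then have "finite (\<Union>i\<in>I. disjoint_pairs (A i) (B i))" using fin by auto
  moreover have "disjoint_pairs (Pow {..<n}) (Pow {..<n}) \<subseteq> (\<Union>i\<in>I. disjoint_pairs (A i) (B i))"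
    using cover unfolding disjoint_pairs_def by fastforce
  ultimately have "3 ^ n \<le> card (\<Union>i\<in>I. disjoint_pairs (A i) (B i))"
    unfolding card_disjoint_pairs_Pow[symmetric] by (rule card_mono)
  also have "\<dots> \<le> (\<Sum>i\<in>I. card (disjoint_pairs (A i) (B i)))"
    using fin by (rule card_UN_le)
  also have "\<dots> \<le> (\<Sum>i\<in>I. 2 ^ n)"
    by (intro sum_mono) (rule card_disjoint_pairs_rectangle[OF sub ne1])
  finally show ?thesis by simp
qed

text \<open>For \<open>a = {}\<close> the functional need not vanish anywhere, so no facet contains its zero set;
  the extra rectangle \<open>{{}} \<times> Pow {..<m}\<close> takes care of this and accounts for the \<open>Suc\<close>.\<close>

lemma xc_lower_bound:
  fixes Q :: "(nat \<Rightarrow> real) set" and l :: "nat set \<Rightarrow> (nat \<Rightarrow> real) \<Rightarrow> real"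
  assumes Q: "polytope Q"
    and lin: "\<And>a. a \<subseteq> {..<m} \<Longrightarrow> linear (l a)"
    and nn: "\<And>a x. a \<subseteq> {..<m} \<Longrightarrow> x \<in> Q \<Longrightarrow> l a x + c a \<ge> 0"
    and v: "\<And>b. b \<subseteq> {..<m} \<Longrightarrow> v b \<in> Q"
    and slack: "\<And>a b. a \<subseteq> {..<m} \<Longrightarrow> b \<subseteq> {..<m} \<Longrightarrow> l a (v b) + c a = (1 - real (card (a \<inter> b)))\<^sup>2"
  shows "3 ^ m \<le> Suc (xc Q) * 2 ^ m"
proof -
  \<comment> \<open>\<open>Q\<close> under the identity is itself an extension, so the
    \<open>LEAST\<close> in \<open>xc\<close> is attained by some \<open>P\<close>.\<close>
  have "\<exists>k. \<exists>P :: (nat \<Rightarrow> real) set. polytope P \<and>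
      (\<exists>f. linear f \<and> f ` P = Q) \<and> card {F. gen_facet_of F P} = k"
    using Q by (intro exI[of _ "card {F. gen_facet_of F Q}"] exI[of _ Q] conjI exI[of _ "\<lambda>x. x"])
      (auto simp: linear_ident)
  from LeastI_ex[OF this, folded xc_def]
  obtain P :: "(nat \<Rightarrow> real) set" and f where P: "polytope P" "linear f" "f ` P = Q"
    and k: "card {F. gen_facet_of F P} = xc Q" by auto
  have "\<exists>x. x \<in> P \<and> f x = v b" if "b \<in> Pow {..<m}" for b
  proof -
    have "v b \<in> f ` P" using v[of b] that P(3) by simp
    then show ?thesis by (elim imageE) auto
  qed
  then have "\<exists>p. \<forall>b\<in>Pow {..<m}. p b \<in> P \<and> f (p b) = v b"
    by (intro bchoice ballI)
  then obtain p where p: "\<And>b. b \<subseteq> {..<m} \<Longrightarrow> p b \<in> P" "\<And>b. b \<subseteq> {..<m} \<Longrightarrow> f (p b) = v b"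
    by auto
  define FF where "FF = {F. gen_facet_of F P}"
  have finFF: "finite FF" unfolding FF_def by (rule finite_gen_facets[OF P(1)])
  define G where "G a = {x \<in> P. l a (f x) + c a = 0}" for a
  \<comment> \<open>A facet \<open>F\<close> yields the rectangle of those \<open>a\<close> whose
    zero face lies in \<open>F\<close> against those \<open>b\<close> whose lifted point avoids
    \<open>F\<close>. Slack 0 at \<open>(a, b)\<close> would put \<open>p b\<close> into
    \<open>G a\<close> and hence into \<open>F\<close>.\<close>
  define A where "A i = (case i of None \<Rightarrow> {{}} | Some F \<Rightarrow> {a. a \<subseteq> {..<m} \<and> G a \<subseteq> F})" for i
  define B where "B i = (case i of None \<Rightarrow> Pow {..<m} | Some F \<Rightarrow> {b. b \<subseteq> {..<m} \<and> p b \<notin> F})" for i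
  have "3 ^ m \<le> card (insert None (Some ` FF)) * 2 ^ m"
  proof (rule rectangle_cover_card[of _ A _ B])
    fix i a b assume i: "i \<in> insert None (Some ` FF)" "a \<in> A i" "b \<in> B i"
    show "card (a \<inter> b) \<noteq> 1"
    proof
      assume one: "card (a \<inter> b) = 1"
      then obtain F where "i = Some F" using i by (cases i) (auto simp: A_def)
      then have ab: "a \<subseteq> {..<m}" "G a \<subseteq> F" "b \<subseteq> {..<m}" "p b \<notin> F"
        using i by (auto simp: A_def B_def)
      then have "p b \<in> G a" using p slack one unfolding G_def by simp
      then show False using ab by auto
    qed
  next
    fix a b assume ab: "a \<subseteq> {..<m}" "b \<subseteq> {..<m}" "a \<inter> b = {}"
    show "\<exists>i\<in>insert None (Some ` FF). a \<in> A i \<and> b \<in> B i"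
    proof (cases "a = {}")
      case True
      then show ?thesis using ab by (auto simp: A_def B_def)
    next
      case False
      \<comment> \<open>For \<open>j\<close> in \<open>a\<close> the singleton \<open>{j}\<close>
        has slack 0, so the zero face of \<open>a\<close> is nonempty, as facet separation demands;
        the pair \<open>(a, b)\<close> itself has slack 1.\<close>
      then obtain j where j: "j \<in> a" by auto
      then have jm: "{j} \<subseteq> {..<m}" using ab by auto
      show ?thesis
      proof (rule facet_separating_from_face[of P "\<lambda>x. l a (f x)" "c a" "p b" "p {j}"])
        show "linear (\<lambda>x. l a (f x))"
          using linear_compose[OF P(2) lin[OF ab(1)]] by (simp add: o_def)
        show "l a (f x) + c a \<ge> 0" if "x \<in> P" for x using nn ab(1) P(3) that by auto
        show "l a (f (p b)) + c a > 0" using p slack ab by simp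
        show "l a (f (p {j})) + c a = 0" using p(2)[OF jm] slack[OF ab(1) jm] j by simp
        fix F assume "gen_facet_of F P" "{x \<in> P. l a (f x) + c a = 0} \<subseteq> F" "p b \<notin> F"
        then show ?thesis using ab
          by (intro bexI[of _ "Some F"]) (auto simp: A_def B_def FF_def G_def)
      qed (use P(1) p(1)[OF ab(2)] p(1)[OF jm] in auto)
    qed
  qed (use finFF in \<open>auto simp: A_def B_def split: option.splits\<close>)
  also have "card (insert None (Some ` FF)) = Suc (xc Q)"
    using finFF k by (simp add: card_image FF_def image_iff)
  finally show ?thesis .
qed

section \<open>The formulas\<close>

text \<open>Position \<open>p = 2 * m * i + k\<close> with \<open>k < 2 * m\<close> carries three variables: \<open>3 * p\<close> is the \<open>k\<close>-th
  copy of \<open>x_i\<close> (negated for odd \<open>k\<close>), \<open>3 * p + 1\<close> is the padding variable of the chain clause at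
  \<open>p\<close>, and, if \<open>k = 2 * j\<close>, \<open>3 * p + 2\<close> is the product variable \<open>y_{ij}\<close>.\<close>

definition slot :: "nat \<Rightarrow> nat \<Rightarrow> nat \<Rightarrow> nat" where
  "slot m i j = 2 * m * i + 2 * j"

text \<open>The filter drops the last position of each block of length \<open>2 * m\<close>, so no
  chain clause links copies of different variables.\<close>

definition chain_positions :: "nat \<Rightarrow> nat list" where
  "chain_positions m = filter (\<lambda>p. Suc p mod (2 * m) \<noteq> 0) [0..<2 * m * m]"

definition chain_clause :: "nat \<Rightarrow> clause" where
  "chain_clause p = [(3 * p, True), (3 * Suc p, True), (3 * p + 1, True)]"

definition index_pairs :: "nat \<Rightarrow> (nat \<times> nat) list" where
  "index_pairs m = filter (\<lambda>(i, j). i < j) (List.product [0..<m] [0..<m])"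

text \<open>The clause for \<open>i < j\<close> takes the \<open>2 * j\<close>-th copy of
  \<open>x_i\<close> and the \<open>2 * i\<close>-th copy of \<open>x_j\<close>, so different pairs
  never share a copy.\<close>

definition pair_clause :: "nat \<Rightarrow> nat \<times> nat \<Rightarrow> clause" where
  "pair_clause m = (\<lambda>(i, j). [(3 * slot m i j, False), (3 * slot m j i, False), (3 * slot m i j + 2, True)])"

definition cor_formula :: "nat \<Rightarrow> cnf" where
  "cor_formula m = (6 * m * m,
     map chain_clause (chain_positions m) @ map (pair_clause m) (index_pairs m))"

lemma nvars_cor_formula [simp]: "nvars (cor_formula m) = 6 * m * m"
  by (simp add: nvars_def cor_formula_def)

lemma clauses_cor_formula: "clauses (cor_formula m) =
    map chain_clause (chain_positions m) @ map (pair_clause m) (index_pairs m)"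
  by (simp add: clauses_def cor_formula_def)

lemma slot_inject:
  assumes "j < m" "j' < m" "slot m i j = slot m i' j'"
  shows "i = i' \<and> j = j'"
proof -
  have d: "slot m i j div (2 * m) = i" if "j < m" for i j
    using that by (simp add: slot_def)
  have "i = i'" using d[of j i] d[of j' i'] assms by metis
  then show ?thesis using assms(3) by (simp add: slot_def)
qed

lemma less_block:
  assumes "i < m" "k < 2 * m"
  shows "2 * m * i + k < 2 * m * (m :: nat)"
proof -
  have "2 * m * i + k < 2 * m * Suc i" using assms by simp
  also have "\<dots> \<le> 2 * m * m" using assms(1) by (intro mult_le_mono2) simp
  finally show ?thesis .
qed

lemma slot_less: "i < m \<Longrightarrow> j < m \<Longrightarrow> slot m i j < 2 * m * m"
  unfolding slot_def by (rule less_block) auto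

lemma set_index_pairs: "set (index_pairs m) = {(i, j). i < j \<and> j < m}"
  unfolding index_pairs_def by auto

lemma distinct_index_pairs: "distinct (index_pairs m)"
  unfolding index_pairs_def by (intro distinct_filter distinct_product) auto

lemma chain_positions_less: "p \<in> set (chain_positions m) \<Longrightarrow> Suc p < 2 * m * m"
proof -
  assume p: "p \<in> set (chain_positions m)"
  then have "Suc p \<noteq> 2 * m * m" "p < 2 * m * m" unfolding chain_positions_def by auto
  then show ?thesis by simp
qed

lemma distinct_chain_positions: "distinct (chain_positions m)"
  unfolding chain_positions_def by simp

lemma length_chain_positions: "length (chain_positions m) \<le> 2 * m * m"
  unfolding chain_positions_def by (rule order_trans[OF length_filter_le]) simp

lemma is_3cnf_cor_formula: "is_3cnf (cor_formula m)"
proof -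
  have "3 * p + 2 < 6 * m * m" if "p < 2 * m * m" for p using that by simp
  moreover have "\<And>i j. i < j \<Longrightarrow> j < m \<Longrightarrow> slot m i j < 2 * m * m \<and> slot m j i < 2 * m * m"
    by (simp add: slot_less)
  ultimately show ?thesis
    using chain_positions_less[of _ m]
    unfolding is_3cnf_def clauses_cor_formula
    by (fastforce simp: set_index_pairs chain_clause_def pair_clause_def)
qed

lemma cnf_size_cor_formula: "cnf_size (cor_formula m) \<le> 15 * m * m"
proof -
  have "length (index_pairs m) \<le> m * m"
    unfolding index_pairs_def by (rule order_trans[OF length_filter_le]) (simp add: length_product)
  moreover have "sum_list (map length (clauses (cor_formula m))) =
      3 * length (chain_positions m) + 3 * length (index_pairs m)"
    unfolding clauses_cor_formula
    by (simp add: o_def chain_clause_def pair_clause_def case_prod_unfold sum_list_triv)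
  ultimately show ?thesis
    using length_chain_positions[of m] unfolding cnf_size_def by simp
qed

section \<open>Occurrences of literals\<close>

lemma sum_list_of_bool_le_1:
  assumes "distinct xs" "\<And>x y. x \<in> set xs \<Longrightarrow> y \<in> set xs \<Longrightarrow> P x \<Longrightarrow> P y \<Longrightarrow> x = y"
  shows "sum_list (map (\<lambda>x. of_bool (P x) :: nat) xs) \<le> 1"
  using assms
proof (induction xs)
  case (Cons x xs)
  show ?case
  proof (cases "P x")
    case True
    then have "\<forall>y\<in>set xs. \<not> P y" using Cons.prems by auto
    then show ?thesis using True by (simp add: sum_list_eq_0_iff)
  next
    case False
    then show ?thesis using Cons by auto
  qed
qed simp

text \<open>The residue of \<open>q\<close> modulo 3 tells copies, padding and product variables
  apart. A copy occurs at most once as the left and once as the right end of a chain clause; padding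
  and product variables occur at most once.\<close>

lemma pos_occ_cor_formula: "pos_occ (cor_formula m) q \<le> 2"
proof -
  let ?C = "chain_positions m" and ?I = "index_pairs m"
  define s1 where "s1 = sum_list (map (\<lambda>p. of_bool (q = 3 * p) :: nat) ?C)"
  define s2 where "s2 = sum_list (map (\<lambda>p. of_bool (q = 3 * Suc p) :: nat) ?C)"
  define s3 where "s3 = sum_list (map (\<lambda>p. of_bool (q = 3 * p + 1) :: nat) ?C)"
  define s4 where "s4 = sum_list (map (\<lambda>(i, j). of_bool (q = 3 * slot m i j + 2) :: nat) ?I)"
  have "count_list (chain_clause p) (q, True) =
      of_bool (q = 3 * p) + of_bool (q = 3 * Suc p) + of_bool (q = 3 * p + 1)" for p
    unfolding chain_clause_def by auto
  moreover have "count_list (pair_clause m ij) (q, True) =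
      (case ij of (i, j) \<Rightarrow> of_bool (q = 3 * slot m i j + 2))" for ij
    unfolding pair_clause_def by (auto split: prod.splits)
  ultimately have occ: "pos_occ (cor_formula m) q = s1 + s2 + s3 + s4"
    unfolding pos_occ_def clauses_cor_formula s1_def s2_def s3_def s4_def
    by (simp add: o_def sum_list_addf)
  have le1: "s1 \<le> 1" "s2 \<le> 1" "s3 \<le> 1"
    unfolding s1_def s2_def s3_def by (intro sum_list_of_bool_le_1 distinct_chain_positions; simp)+
  have "s4 \<le> 1"
    unfolding s4_def case_prod_unfold
  proof (rule sum_list_of_bool_le_1[OF distinct_index_pairs])
    fix x y assume "x \<in> set (index_pairs m)" "y \<in> set (index_pairs m)"
      and "q = 3 * slot m (fst x) (snd x) + 2" "q = 3 * slot m (fst y) (snd y) + 2"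
    then show "x = y"
      using slot_inject[of "snd x" m "snd y" "fst x" "fst y"]
      by (simp add: set_index_pairs case_prod_unfold prod_eq_iff)
  qed
  moreover have "q mod 3 = 0 \<or> q mod 3 = 1 \<or> q mod 3 = 2" by presburger
  moreover have "s1 = 0 \<and> s2 = 0" if "q mod 3 \<noteq> 0"
  proof -
    have "q \<noteq> 3 * p \<and> q \<noteq> 3 * Suc p" for p using that by presburger
    then show ?thesis unfolding s1_def s2_def by simp
  qed
  moreover have "s3 = 0" if "q mod 3 \<noteq> 1"
  proof -
    have "q \<noteq> 3 * p + 1" for p using that by presburger
    then show ?thesis unfolding s3_def by simp
  qed
  moreover have "s4 = 0" if "q mod 3 \<noteq> 2"
  proof -
    have "q \<noteq> 3 * p + 2" for p using that by presburger
    then show ?thesis unfolding s4_def by (simp add: case_prod_unfold)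
  qed
  ultimately show ?thesis using occ le1 by linarith
qed

text \<open>Negated literals come only from pair clauses. The position \<open>slot m i j\<close>
  determines the ordered pair \<open>(i, j)\<close> and thereby the clause, since exactly one of the
  two orders is increasing.\<close>

lemma neg_occ_cor_formula: "neg_occ (cor_formula m) q \<le> 1"
proof -
  have "count_list (chain_clause p) (q, False) = 0" for p
    unfolding chain_clause_def by auto
  then have "neg_occ (cor_formula m) q =
      sum_list (map (\<lambda>ij. count_list (pair_clause m ij) (q, False)) (index_pairs m))"
    unfolding neg_occ_def clauses_cor_formula by (simp add: o_def)
  also have "\<dots> = sum_list (map (\<lambda>ij. of_bool (q = 3 * slot m (fst ij) (snd ij) \<or>
      q = 3 * slot m (snd ij) (fst ij))) (index_pairs m))"
  proof (intro arg_cong[of _ _ sum_list] map_cong refl)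
    fix ij assume "ij \<in> set (index_pairs m)"
    then obtain i j where "ij = (i, j)" "i < j" "j < m" by (auto simp: set_index_pairs)
    then show "count_list (pair_clause m ij) (q, False) =
        of_bool (q = 3 * slot m (fst ij) (snd ij) \<or> q = 3 * slot m (snd ij) (fst ij))"
      using slot_inject[of j m i i j] by (auto simp: pair_clause_def)
  qed
  also have "\<dots> \<le> 1"
  proof (rule sum_list_of_bool_le_1[OF distinct_index_pairs])
    fix x y
    assume "x \<in> set (index_pairs m)" "y \<in> set (index_pairs m)"
      and x: "q = 3 * slot m (fst x) (snd x) \<or> q = 3 * slot m (snd x) (fst x)"
      and y: "q = 3 * slot m (fst y) (snd y) \<or> q = 3 * slot m (snd y) (fst y)"
    then obtain i j i' j' where xy: "x = (i, j)" "y = (i', j')" "i < j" "j < m" "i' < j'" "j' < m"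
      by (auto simp: set_index_pairs)
    then have "slot m i j = slot m i' j' \<or> slot m i j = slot m j' i' \<or>
        slot m j i = slot m i' j' \<or> slot m j i = slot m j' i'"
      using x y by auto
    then show "x = y"
      using slot_inject[of j m j' i i'] slot_inject[of j m i' i j'] slot_inject[of i m j' j i']
        slot_inject[of i m i' j j'] xy by auto
  qed
  finally show ?thesis .
qed

section \<open>The satisfiability polytope and its linearized slack\<close>

definition assignment_point :: "nat \<Rightarrow> (nat \<Rightarrow> bool) \<Rightarrow> nat \<Rightarrow> real" where
  "assignment_point N a = (\<lambda>i. if i < N \<and> a i then 1 else 0)"

lemma sat_polytope_eq:
  "sat_polytope \<phi> = convex hull (assignment_point (nvars \<phi>) ` {a. satisfies a \<phi>})"
  unfolding sat_polytope_def assignment_point_def by (rule arg_cong[of _ _ "\<lambda>X. convex hull X"]) auto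

text \<open>There are infinitely many assignments, but a point depends only on the values below
  \<open>N\<close>, that is, on a subset of \<open>{..<N}\<close>.\<close>

lemma polytope_sat_polytope: "polytope (sat_polytope \<phi>)"
proof -
  have "range (assignment_point N) \<subseteq> (\<lambda>S. assignment_point N (\<lambda>i. i \<in> S)) ` Pow {..<N}" for N
  proof (rule image_subsetI)
    fix a
    have "assignment_point N a = assignment_point N (\<lambda>i. i \<in> {i. i < N \<and> a i})"
      unfolding assignment_point_def by auto
    then show "assignment_point N a \<in> (\<lambda>S. assignment_point N (\<lambda>i. i \<in> S)) ` Pow {..<N}"
      by (rule image_eqI) auto
  qed
  then have "finite (range (assignment_point N))" for N
    by (rule finite_subset) simp
  then have "finite (assignment_point (nvars \<phi>) ` {a. satisfies a \<phi>})"
    by (rule finite_subset[rotated]) auto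
  then show ?thesis unfolding polytope_def sat_polytope_eq by blast
qed

text \<open>The square of \<open>S\<close> splits into the increasing pairs, their mirror images and
  the diagonal. This count is what linearizes the square of a sum of 0/1 variables.\<close>

lemma card_increasing_pairs:
  fixes S :: "nat set"
  assumes "finite S"
  shows "2 * card {(i, j) \<in> S \<times> S. i < j} + card S = card S * card S"
proof -
  define L U D where "L = {(i, j) \<in> S \<times> S. i < j}" and "U = {(i, j) \<in> S \<times> S. j < i}"
    and "D = (\<lambda>i. (i, i)) ` S"
  have un: "S \<times> S = L \<union> U \<union> D" unfolding L_def U_def D_def by auto
  then have fin: "finite L" "finite U" "finite D"
    using assms by (metis finite_SigmaI finite_Un)+
  have "L \<inter> U = {}" "(L \<union> U) \<inter> D = {}" unfolding L_def U_def D_def by auto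
  then have "card (S \<times> S) = card L + card U + card D"
    using fin un by (simp add: card_Un_disjoint)
  moreover have "card D = card S" unfolding D_def by (intro card_image inj_onI) auto
  moreover have "U = prod.swap ` L" unfolding L_def U_def by auto
  then have "card U = card L" by (simp add: card_image)
  ultimately show ?thesis using card_cartesian_product[of S S] unfolding L_def by simp
qed

text \<open>With the constant below, the first sum is \<open>m\<close> times a penalty that vanishes exactly when the
  padding variables are 0 and consecutive copies are complementary. Then the rest is
  \<open>1 - \<Sum> x_i + 2 \<Sum> y_{ij}\<close>, the linearization of \<open>(1 - \<Sum> x_i)\<^sup>2\<close>; otherwise
  the penalty outweighs it.\<close>

definition cor_functional :: "nat \<Rightarrow> nat set \<Rightarrow> (nat \<Rightarrow> real) \<Rightarrow> real" where
  "cor_functional m a x =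
     (\<Sum>p\<in>set (chain_positions m). real m * (x (3 * p) + x (3 * Suc p) + 2 * x (3 * p + 1)))
     + 2 * (\<Sum>(i, j)\<in>{(i, j) \<in> a \<times> a. i < j}. x (3 * slot m i j + 2))
     - (\<Sum>i\<in>a. x (3 * slot m i 0))"

definition cor_constant :: "nat \<Rightarrow> real" where
  "cor_constant m = 1 - real m * real (card (set (chain_positions m)))"

lemma linear_cor_functional: "linear (cor_functional m a)"
  by (rule linearI) (simp_all add: cor_functional_def scaleR_fun_def case_prod_unfold
      sum.distrib sum_distrib_left algebra_simps)

lemma cor_functional_assignment_point:
  assumes a: "a \<subseteq> {..<m}"
  shows "cor_functional m a (assignment_point (6 * m * m) A) + cor_constant m =
    real m * (\<Sum>p\<in>set (chain_positions m).
        of_bool (A (3 * p)) + of_bool (A (3 * Suc p)) + 2 * of_bool (A (3 * p + 1)) - 1)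
    + 2 * real (card {(i, j) \<in> a \<times> a. i < j \<and> A (3 * slot m i j + 2)})
    + 1 - real (card {i \<in> a. A (3 * slot m i 0)})"
proof -
  let ?x = "assignment_point (6 * m * m) A"
  have fin: "finite a" using a finite_subset by blast
  have x: "?x q = of_bool (A q)" if "q < 6 * m * m" for q
    using that unfolding assignment_point_def by simp
  have s: "slot m i j < 2 * m * m" if "i \<in> a" "j \<in> a" for i j
    using that a by (meson lessThan_iff slot_less subsetD)
  define g :: "nat \<Rightarrow> real" where
    "g p = of_bool (A (3 * p)) + of_bool (A (3 * Suc p)) + 2 * of_bool (A (3 * p + 1))" for p
  have "(\<Sum>p\<in>set (chain_positions m). real m * (?x (3 * p) + ?x (3 * Suc p) + 2 * ?x (3 * p + 1))) =
      (\<Sum>p\<in>set (chain_positions m). real m * g p)"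
    unfolding g_def
    by (intro sum.cong refl arg_cong2[of _ _ _ _ "(*)"] arg_cong2[of _ _ _ _ "(+)"] x)
      (use chain_positions_less[of _ m] in fastforce)+
  moreover have "(\<Sum>i\<in>a. ?x (3 * slot m i 0)) = real (card {i \<in> a. A (3 * slot m i 0)})"
  proof -
    have "(\<Sum>i\<in>a. ?x (3 * slot m i 0)) = (\<Sum>i\<in>a. of_bool (A (3 * slot m i 0)))"
      using a slot_less[of _ m 0] by (intro sum.cong refl x) fastforce
    then show ?thesis using fin by (simp add: sum_of_bool_eq Int_def)
  qed
  moreover have "(\<Sum>(i, j)\<in>{(i, j) \<in> a \<times> a. i < j}. ?x (3 * slot m i j + 2)) =
      real (card {(i, j) \<in> a \<times> a. i < j \<and> A (3 * slot m i j + 2)})"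
  proof -
    have "(\<Sum>(i, j)\<in>{(i, j) \<in> a \<times> a. i < j}. ?x (3 * slot m i j + 2)) =
        (\<Sum>ij\<in>{(i, j) \<in> a \<times> a. i < j}. of_bool (A (3 * slot m (fst ij) (snd ij) + 2)))"
    proof (intro sum.cong refl)
      fix ij assume "ij \<in> {(i, j) \<in> a \<times> a. i < j}"
      then have "slot m (fst ij) (snd ij) < 2 * m * m" using s by auto
      then have "3 * slot m (fst ij) (snd ij) + 2 < 6 * m * m" by simp
      from x[OF this] show "(case ij of (i, j) \<Rightarrow> ?x (3 * slot m i j + 2)) =
          of_bool (A (3 * slot m (fst ij) (snd ij) + 2))"
        by (simp add: case_prod_unfold)
    qed
    also have "\<dots> = real (card ({(i, j) \<in> a \<times> a. i < j} \<inter> {ij. A (3 * slot m (fst ij) (snd ij) + 2)}))"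
      using fin by (intro sum_of_bool_eq) (auto intro: finite_subset[of _ "a \<times> a"])
    also have "{(i, j) \<in> a \<times> a. i < j} \<inter> {ij. A (3 * slot m (fst ij) (snd ij) + 2)} =
        {(i, j) \<in> a \<times> a. i < j \<and> A (3 * slot m i j + 2)}" by auto
    finally show ?thesis .
  qed
  ultimately show ?thesis
    unfolding cor_functional_def cor_constant_def g_def[symmetric]
    by (simp add: sum_subtractf sum_distrib_left[symmetric] algebra_simps)
qed

text \<open>If some penalty is at least 1, its factor \<open>m\<close> pays for the at most
  \<open>m\<close> subtracted copies. Otherwise every chain alternates, the pair clauses force the
  product variables of all pairs of selected indices, and the value is at least
  \<open>(1 - s)\<^sup>2\<close>.\<close>

lemma cor_functional_nonneg:
  assumes a: "a \<subseteq> {..<m}" and sat: "satisfies A (cor_formula m)"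
  shows "cor_functional m a (assignment_point (6 * m * m) A) + cor_constant m \<ge> 0"
proof -
  define t :: "nat \<Rightarrow> real" where
    "t p = of_bool (A (3 * p)) + of_bool (A (3 * Suc p)) + 2 * of_bool (A (3 * p + 1)) - 1" for p
  define s where "s = card {i \<in> a. A (3 * slot m i 0)}"
  define y where "y = card {(i, j) \<in> a \<times> a. i < j \<and> A (3 * slot m i j + 2)}"
  have fin: "finite a" using a finite_subset by blast
  have val: "cor_functional m a (assignment_point (6 * m * m) A) + cor_constant m =
      real m * (\<Sum>p\<in>set (chain_positions m). t p) + 2 * real y + 1 - real s"
    unfolding cor_functional_assignment_point[OF a] t_def s_def y_def by simp
  have chain: "A (3 * p) \<or> A (3 * Suc p) \<or> A (3 * p + 1)" if "p \<in> set (chain_positions m)" for p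
    using sat that unfolding satisfies_def clauses_cor_formula
    by (auto simp: chain_clause_def ball_Un)
  have pair: "A (3 * slot m i j + 2)" if "i < j" "j < m" "A (3 * slot m i j)" "A (3 * slot m j i)" for i j
  proof -
    have "pair_clause m (i, j) \<in> set (clauses (cor_formula m))"
      using that unfolding clauses_cor_formula by (auto simp: set_index_pairs)
    then show ?thesis using sat that unfolding satisfies_def by (auto simp: pair_clause_def)
  qed
  have t0: "t p \<ge> 0" if "p \<in> set (chain_positions m)" for p
    using chain[OF that] unfolding t_def by auto
  show ?thesis
  proof (cases "\<exists>p\<in>set (chain_positions m). t p \<ge> 1")
    case True
    then obtain p where p: "p \<in> set (chain_positions m)" "t p \<ge> 1" by auto
    have "t p \<le> (\<Sum>p\<in>set (chain_positions m). t p)"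
      using p t0 by (intro member_le_sum) auto
    then have "real m * 1 \<le> real m * (\<Sum>p\<in>set (chain_positions m). t p)"
      using p by (intro mult_left_mono) auto
    moreover have "s \<le> m"
      unfolding s_def using card_mono[of "{..<m}" "{i \<in> a. A (3 * slot m i 0)}"] a by auto
    ultimately show ?thesis unfolding val by simp
  next
    case False
    \<comment> \<open>A penalty below 1 is 0 by integrality: the weight 2 excludes a true padding
      variable, and then the chain clause leaves exactly one of the two neighbours true.\<close>
    have alt: "A (3 * Suc p) \<longleftrightarrow> \<not> A (3 * p)" if "p \<in> set (chain_positions m)" for p
      using False chain[OF that] that unfolding t_def by (auto split: if_splits)
    have "A (3 * (2 * m * i + k)) \<longleftrightarrow> A (3 * slot m i 0) = even k" if "i < m" "k < 2 * m" for i k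
      using that(2)
    proof (induction k)
      case (Suc k)
      have "2 * m * i + k < 2 * m * m" using less_block[of i m k] that(1) Suc.prems by simp
      moreover have "Suc (2 * m * i + k) mod (2 * m) = Suc k"
        using Suc.prems mod_mult_self4[of "2 * m" i "Suc k"] by simp
      ultimately have "2 * m * i + k \<in> set (chain_positions m)" unfolding chain_positions_def by simp
      from alt[OF this] show ?case using Suc by auto
    qed (simp add: slot_def)
    \<comment> \<open>Slots sit at even offsets, where the alternating chain returns to the value of
      the first copy.\<close>
    from this[of _ "2 * _"] have copies: "A (3 * slot m i j) \<longleftrightarrow> A (3 * slot m i 0)"
      if "i < m" "j < m" for i j
      using that unfolding slot_def by simp
    let ?S = "{i \<in> a. A (3 * slot m i 0)}"
    have "{(i, j) \<in> ?S \<times> ?S. i < j} \<subseteq> {(i, j) \<in> a \<times> a. i < j \<and> A (3 * slot m i j + 2)}"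
    proof (rule subrelI)
      fix i j assume ij: "(i, j) \<in> {(i, j) \<in> ?S \<times> ?S. i < j}"
      then have lt: "i < j" "i < m" "j < m" using a by auto
      then have "A (3 * slot m i j + 2)" using ij copies[of i j] copies[of j i] pair[of i j] by simp
      then show "(i, j) \<in> {(i, j) \<in> a \<times> a. i < j \<and> A (3 * slot m i j + 2)}" using ij by simp
    qed
    then have "card {(i, j) \<in> ?S \<times> ?S. i < j} \<le> y"
      unfolding y_def using fin
      by (intro card_mono) (auto intro: finite_subset[of _ "a \<times> a"])
    moreover have "2 * card {(i, j) \<in> ?S \<times> ?S. i < j} + s = s * s"
      unfolding s_def using fin by (intro card_increasing_pairs) simp
    ultimately have "s * s \<le> 2 * y + s" by linarith
    then have "real s * real s \<le> 2 * real y + real s"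
      by (metis of_nat_add of_nat_le_iff of_nat_mult of_nat_numeral)
    moreover have "0 \<le> (1 - real s)\<^sup>2" by simp
    ultimately have "0 \<le> 2 * real y + 1 - real s"
      by (simp add: power2_eq_square algebra_simps)
    moreover have "0 \<le> real m * (\<Sum>p\<in>set (chain_positions m). t p)"
      using t0 by (intro mult_nonneg_nonneg sum_nonneg) auto
    ultimately show ?thesis unfolding val by simp
  qed
qed

text \<open>The intended assignment for the set \<open>b\<close>: a variable number \<open>q\<close>
  is decoded into index \<open>i\<close>, offset \<open>k\<close> and kind \<open>q mod 3\<close>.
  Copies alternate along the block, padding is false, and at offset \<open>k = 2 * j\<close> the
  term \<open>k div 2\<close> recovers the second index \<open>j\<close> of the product.\<close>

definition cor_assignment :: "nat \<Rightarrow> nat set \<Rightarrow> nat \<Rightarrow> bool" where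
  "cor_assignment m b q = (let p = q div 3; i = p div (2 * m); k = p mod (2 * m) in
     if q mod 3 = 0 then (i \<in> b) = even k
     else q mod 3 = 2 \<and> i \<in> b \<and> k div 2 \<in> b)"

lemma cor_assignment_slot:
  assumes "j < m"
  shows "cor_assignment m b (3 * slot m i j) \<longleftrightarrow> i \<in> b"
    and "cor_assignment m b (3 * slot m i j + 2) \<longleftrightarrow> i \<in> b \<and> j \<in> b"
proof -
  have "slot m i j div (2 * m) = i" "slot m i j mod (2 * m) = 2 * j"
    using assms by (simp_all add: slot_def)
  moreover have "(3 * slot m i j + 2) div 3 = slot m i j" "(3 * slot m i j + 2) mod 3 = 2" by presburger+
  ultimately show "cor_assignment m b (3 * slot m i j) \<longleftrightarrow> i \<in> b"
    "cor_assignment m b (3 * slot m i j + 2) \<longleftrightarrow> i \<in> b \<and> j \<in> b"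
    by (simp_all add: cor_assignment_def)
qed

lemma cor_assignment_chain:
  assumes "p \<in> set (chain_positions m)"
  shows "cor_assignment m b (3 * Suc p) \<longleftrightarrow> \<not> cor_assignment m b (3 * p)"
    and "\<not> cor_assignment m b (3 * p + 1)"
proof -
  have nz: "Suc p mod (2 * m) \<noteq> 0" using assms unfolding chain_positions_def by simp
  then have "Suc p mod (2 * m) = Suc (p mod (2 * m))" by (metis mod_Suc)
  moreover have "Suc p div (2 * m) = p div (2 * m)" using nz by (simp add: div_Suc)
  moreover have "3 * p mod 3 = 0" "3 * p div 3 = p" "3 * Suc p mod 3 = 0" "3 * Suc p div 3 = Suc p"
    by presburger+
  ultimately show "cor_assignment m b (3 * Suc p) \<longleftrightarrow> \<not> cor_assignment m b (3 * p)"
    unfolding cor_assignment_def Let_def by auto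
  have "(3 * p + 1) mod 3 = 1" by presburger
  then show "\<not> cor_assignment m b (3 * p + 1)" unfolding cor_assignment_def Let_def by simp
qed

lemma satisfies_cor_assignment: "satisfies (cor_assignment m b) (cor_formula m)"
  unfolding satisfies_def clauses_cor_formula
proof (intro ballI, simp only: set_append Un_iff set_map, elim disjE imageE)
  fix cl p assume "p \<in> set (chain_positions m)" "cl = chain_clause p"
  then show "\<exists>(i, v)\<in>set cl. cor_assignment m b i = v"
    using cor_assignment_chain(1)[of p m b] by (auto simp: chain_clause_def)
next
  fix cl ij assume ij: "ij \<in> set (index_pairs m)" "cl = pair_clause m ij"
  then obtain i j where "ij = (i, j)" "i < j" "j < m" by (auto simp: set_index_pairs)
  then show "\<exists>(i, v)\<in>set cl. cor_assignment m b i = v"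
    using ij cor_assignment_slot[of j m b i] cor_assignment_slot[of i m b j]
    by (auto simp: pair_clause_def)
qed

text \<open>All penalties vanish at this point, and with \<open>s = card (a \<inter> b)\<close> the
  rest is \<open>1 - s + s * (s - 1)\<close>, which is \<open>(1 - s)\<^sup>2\<close>.\<close>

lemma cor_functional_cor_assignment:
  assumes "a \<subseteq> {..<m}" "b \<subseteq> {..<m}"
  shows "cor_functional m a (assignment_point (6 * m * m) (cor_assignment m b)) + cor_constant m =
    (1 - real (card (a \<inter> b)))\<^sup>2"
proof -
  let ?A = "cor_assignment m b"
  have fin: "finite (a \<inter> b)" using assms finite_subset by blast
  have "(\<Sum>p\<in>set (chain_positions m).
        of_bool (?A (3 * p)) + of_bool (?A (3 * Suc p)) + 2 * of_bool (?A (3 * p + 1)) - 1 :: real) = 0"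
  proof (intro sum.neutral ballI)
    fix p assume "p \<in> set (chain_positions m)"
    from cor_assignment_chain[OF this, of b]
    show "of_bool (?A (3 * p)) + of_bool (?A (3 * Suc p)) + 2 * of_bool (?A (3 * p + 1)) - 1 = (0 :: real)"
      by auto
  qed
  moreover have less: "i < m" if "i \<in> a" for i using assms(1) that by auto
  have "{i \<in> a. ?A (3 * slot m i 0)} = a \<inter> b"
    using less cor_assignment_slot(1)[of 0 m b] by fastforce
  moreover have "{(i, j) \<in> a \<times> a. i < j \<and> ?A (3 * slot m i j + 2)} =
      {(i, j) \<in> (a \<inter> b) \<times> (a \<inter> b). i < j}"
    using less cor_assignment_slot(2)[of _ m b] by fastforce
  moreover have "2 * real (card {(i, j) \<in> (a \<inter> b) \<times> (a \<inter> b). i < j}) + real (card (a \<inter> b)) =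
      real (card (a \<inter> b)) * real (card (a \<inter> b))"
    using arg_cong[OF card_increasing_pairs[OF fin], of real] by simp
  ultimately show ?thesis
    unfolding cor_functional_assignment_point[OF assms(1)] by (simp add: power2_eq_square algebra_simps)
qed

lemma xc_cor_formula: "3 ^ m \<le> Suc (xc (sat_polytope (cor_formula m))) * 2 ^ m"
proof (rule xc_lower_bound[where l = "cor_functional m" and c = "\<lambda>_. cor_constant m"
      and v = "\<lambda>b. assignment_point (6 * m * m) (cor_assignment m b)"])
  show "polytope (sat_polytope (cor_formula m))" by (rule polytope_sat_polytope)
  show "linear (cor_functional m a)" for a by (rule linear_cor_functional)
  show "cor_functional m a x + cor_constant m \<ge> 0"
    if "a \<subseteq> {..<m}" "x \<in> sat_polytope (cor_formula m)" for a x
    using that(2) unfolding sat_polytope_eq nvars_cor_formula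
    by (rule affine_nonneg_on_convex_hull[OF linear_cor_functional, rotated])
      (use that(1) cor_functional_nonneg in auto)
  show "assignment_point (6 * m * m) (cor_assignment m b) \<in> sat_polytope (cor_formula m)" for b
    unfolding sat_polytope_eq nvars_cor_formula
    by (intro hull_inc imageI CollectI satisfies_cor_assignment)
qed (rule cor_functional_cor_assignment)

section \<open>Growth beyond every polynomial\<close>

lemma xc_cor_formula_superpolynomial: "\<exists>m\<ge>1. real (xc (sat_polytope (cor_formula m))) > c * real (m\<^sup>2) ^ d"
proof -
  \<comment> \<open>This writes \<open>(3 / 2) ^ m\<close> as \<open>exp (real m * L)\<close>, so
    the limit of a power over the exponential applies; the power is \<open>2 * d\<close> because the
    polynomial is taken at \<open>m\<^sup>2\<close>.\<close>
  define L :: real where "L = ln (3 / 2)"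
  have L: "L > 0" unfolding L_def by simp
  have exp_L: "exp (real m * L) = (3 / 2) ^ m" for m
    unfolding L_def by (simp add: exp_of_nat_mult)
  have "filterlim (\<lambda>m. real m * L) at_top sequentially"
    by (rule filterlim_at_top_mult_tendsto_pos[OF tendsto_const L filterlim_real_sequentially])
  from filterlim_compose[OF tendsto_power_div_exp_0 this, of "2 * d"]
  have lim: "(\<lambda>m. (real m * L) ^ (2 * d) / (3 / 2) ^ m) \<longlonglongrightarrow> 0"
    by (simp add: exp_L)
  \<comment> \<open>The threshold is chosen so that clearing denominators gives
    \<open>real m ^ (2 * d) * (\<bar>c\<bar> + 1) < (3 / 2) ^ m\<close>; the summand 1 absorbs the
    \<open>Suc\<close> in the bound on \<open>xc\<close>.\<close>
  have "eventually (\<lambda>m. (real m * L) ^ (2 * d) / (3 / 2) ^ m < L ^ (2 * d) / (\<bar>c\<bar> + 1)) sequentially"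
    by (rule order_tendstoD(2)[OF lim]) (use L in simp)
  then have "eventually (\<lambda>m. m \<ge> 1 \<and> (real m * L) ^ (2 * d) / (3 / 2) ^ m < L ^ (2 * d) / (\<bar>c\<bar> + 1)) sequentially"
    by (rule eventually_conj[OF eventually_ge_at_top])
  then obtain m :: nat where m: "m \<ge> 1"
    "(real m * L) ^ (2 * d) / (3 / 2) ^ m < L ^ (2 * d) / (\<bar>c\<bar> + 1)"
    using eventually_happens'[OF sequentially_bot] by blast
  have "L ^ (2 * d) * (real m ^ (2 * d) * (\<bar>c\<bar> + 1)) < L ^ (2 * d) * (3 / 2) ^ m"
  proof -
    have pos: "(3 / 2 :: real) ^ m > 0" "\<bar>c\<bar> + 1 > 0" by auto
    have "(real m * L) ^ (2 * d) * (\<bar>c\<bar> + 1) < L ^ (2 * d) * (3 / 2) ^ m"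
      using m(2) pos by (simp only: divide_less_eq less_divide_eq if_True) (simp add: field_simps)
    then show ?thesis by (simp only: power_mult_distrib mult_ac)
  qed
  then have "real m ^ (2 * d) * (\<bar>c\<bar> + 1) < (3 / 2) ^ m"
    using L by simp
  moreover have "c * real m ^ (2 * d) + 1 \<le> real m ^ (2 * d) * (\<bar>c\<bar> + 1)"
  proof -
    have "c * real m ^ (2 * d) \<le> \<bar>c\<bar> * real m ^ (2 * d)" by (intro mult_right_mono) auto
    moreover have "1 \<le> real m ^ (2 * d)" using m(1) by simp
    ultimately show ?thesis by (simp add: algebra_simps)
  qed
  ultimately have growth: "c * real m ^ (2 * d) + 1 < (3 / 2) ^ m" by simp
  have "(3::real) ^ m \<le> (real (xc (sat_polytope (cor_formula m))) + 1) * 2 ^ m"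
    using of_nat_mono[OF xc_cor_formula[of m], where 'a=real] by (simp add: algebra_simps)
  then have "(3 / 2) ^ m \<le> real (xc (sat_polytope (cor_formula m))) + 1"
    by (simp add: power_divide divide_le_eq)
  then show ?thesis using m(1) growth by (intro exI[of _ m]) (simp add: power_mult)
qed

theorem theorem4:
  shows "\<exists>\<phi> :: nat \<Rightarrow> cnf.
     (\<forall>n\<ge>1. is_3cnf (\<phi> n)) \<and>
     (\<exists>C::real. \<forall>n\<ge>1. real (nvars (\<phi> n)) \<le> C * real n) \<and>
     (\<exists>(c::real) (d::nat). \<forall>n\<ge>1. real (cnf_size (\<phi> n)) \<le> c * real n ^ d) \<and>
     (\<forall>(c::real) (d::nat). \<exists>n\<ge>1. real (xc (sat_polytope (\<phi> n))) > c * real n ^ d) \<and>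
     (\<forall>n\<ge>1. \<forall>i < nvars (\<phi> n). pos_occ (\<phi> n) i \<le> 2 \<and> neg_occ (\<phi> n) i \<le> 1)"
proof (intro exI[of _ "\<lambda>n. cor_formula (floor_sqrt n)"] conjI allI impI)
  \<comment> \<open>With \<open>m = floor_sqrt n\<close>, the bounds quadratic in \<open>m\<close>
    become linear in \<open>n\<close>.\<close>
  have sq: "floor_sqrt n * floor_sqrt n \<le> n" for n
    using floor_sqrt_power2_le[of n] by (simp add: power2_eq_square)
  show "\<exists>C::real. \<forall>n\<ge>1. real (nvars (cor_formula (floor_sqrt n))) \<le> C * real n"
  proof (intro exI[of _ 6] allI impI)
    fix n :: nat
    have "nvars (cor_formula (floor_sqrt n)) \<le> 6 * n" using sq[of n] by simp
    then show "real (nvars (cor_formula (floor_sqrt n))) \<le> 6 * real n"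
      by (metis of_nat_le_iff of_nat_mult of_nat_numeral)
  qed
  show "\<exists>(c::real) (d::nat). \<forall>n\<ge>1. real (cnf_size (cor_formula (floor_sqrt n))) \<le> c * real n ^ d"
  proof (rule exI[of _ 15], rule exI[of _ 1], intro allI impI)
    fix n :: nat
    have "cnf_size (cor_formula (floor_sqrt n)) \<le> 15 * n"
      using sq[of n] cnf_size_cor_formula[of "floor_sqrt n"] by simp
    then show "real (cnf_size (cor_formula (floor_sqrt n))) \<le> 15 * real n ^ 1"
      by (metis of_nat_le_iff of_nat_mult of_nat_numeral power_one_right)
  qed
  fix c :: real and d :: nat
  obtain m where "m \<ge> 1" "real (xc (sat_polytope (cor_formula m))) > c * real (m\<^sup>2) ^ d"
    using xc_cor_formula_superpolynomial by blast
  \<comment> \<open>At \<open>n = m\<^sup>2\<close> the integer square root is exact, so the formula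
    at \<open>n\<close> is the one for \<open>m\<close>.\<close>
  then show "\<exists>n\<ge>1. real (xc (sat_polytope (cor_formula (floor_sqrt n)))) > c * real n ^ d"
    by (intro exI[of _ "m\<^sup>2"]) simp
qed (rule is_3cnf_cor_formula pos_occ_cor_formula neg_occ_cor_formula)+

end
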